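(* Let $G=(V,E)$ be an infinite, connected, locally finite, weighted graph, let $p\in V$, and let $f:V\to[0,\infty)$ be a nonnegative subharmonic function on $G$. Then either $f$ is constant, or for every $q\in(1,\infty)$, $$\liminf_{R\to\infty}\frac{1}{R^2}\sum_{x\in B_R(p)}f(x)^q\,\mu_x=\infty .$$
   Context: A weighted graph $G=(V,E)$ is a graph with vertex set $V$ and (undirected) edge set $E$, with symmetric edge weights $\mu_{xy}=\mu_{yx}>0$ for $xy\in E$, extended by $\mu_{xy}=0$ for $xy\notin E$. Self-loops ($xx\in E$, i.e. $\mu_{xx}>0$) are allowed, multiple edges are not. Locally finite means every vertex has finitely many neighbors. The vertex weight is $\mu_x=\sum_{y}\mu_{xy}$; no uniform upper or lower bound on $\mu_x$ is assumed. The combinatorial distance $d(x,y)$ is the minimal number of edges in a path from $x$ to $y$, and $B_R(p)=\{x\in V: d(x,p)\le R\}$. The normalized Laplace operator is $\Delta f(x)=\frac{1}{\mu_x}\sum_{y}\mu_{xy}(f(y)-f(x))$ for $f:V\to\mathbb{R}$; $f$ is subharmonic if $\Delta f(x)\ge 0$ for all $x\in V$. *)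

theory Defs
  imports "HOL-Analysis.Analysis"
begin

text \<open>
  An undirected edge \<open>xy\<close> is represented by both pairs \<open>(x, y)\<close> and \<open>(y, x)\<close>; a pair \<open>(x, x)\<close> is a
  self-loop. The weights are total functions, vanishing off the edge set.
\<close>

locale weighted_graph =
  fixes V :: "'a set" and E :: "('a \<times> 'a) set" and \<mu> :: "'a \<Rightarrow> 'a \<Rightarrow> real"
  assumes edges_in_vertices: "E \<subseteq> V \<times> V"
    and edges_sym: "sym E"
    and weight_sym: "\<mu> x y = \<mu> y x"
    and weight_pos: "(x, y) \<in> E \<Longrightarrow> \<mu> x y > 0"
    and weight_zero: "(x, y) \<notin> E \<Longrightarrow> \<mu> x y = 0"

definition locally_finite_graph :: "'a set \<Rightarrow> ('a \<times> 'a) set \<Rightarrow> bool" where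
  "locally_finite_graph V E \<longleftrightarrow> (\<forall>x\<in>V. finite (E `` {x}))"

definition connected_graph :: "'a set \<Rightarrow> ('a \<times> 'a) set \<Rightarrow> bool" where
  "connected_graph V E \<longleftrightarrow> (\<forall>x\<in>V. \<forall>y\<in>V. (x, y) \<in> E\<^sup>*)"

text \<open>
  \<open>(x, y) \<in> E ^^ n\<close> says that some path with exactly \<open>n\<close> edges joins \<open>x\<close> to \<open>y\<close>. The distance is
  meaningful only when such a path exists, as it always does between vertices of a connected graph.
\<close>

definition graph_dist :: "('a \<times> 'a) set \<Rightarrow> 'a \<Rightarrow> 'a \<Rightarrow> nat" where
  "graph_dist E x y = (LEAST n. (x, y) \<in> E ^^ n)"

definition graph_ball :: "'a set \<Rightarrow> ('a \<times> 'a) set \<Rightarrow> 'a \<Rightarrow> real \<Rightarrow> 'a set" where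
  "graph_ball V E p R = {x \<in> V. real (graph_dist E x p) \<le> R}"

text \<open>
  The sums over \<open>y\<close> below run over the neighbours of \<open>x\<close> (including \<open>x\<close> itself if it carries a loop);
  all other weights \<open>\<mu> x y\<close> vanish. Under local finiteness these are finite sums.
\<close>

definition vertex_weight :: "('a \<times> 'a) set \<Rightarrow> ('a \<Rightarrow> 'a \<Rightarrow> real) \<Rightarrow> 'a \<Rightarrow> real" where
  "vertex_weight E \<mu> x = (\<Sum>y\<in>E `` {x}. \<mu> x y)"

definition graph_laplacian ::
    "('a \<times> 'a) set \<Rightarrow> ('a \<Rightarrow> 'a \<Rightarrow> real) \<Rightarrow> ('a \<Rightarrow> real) \<Rightarrow> 'a \<Rightarrow> real" where
  "graph_laplacian E \<mu> f x = 1 / vertex_weight E \<mu> x * (\<Sum>y\<in>E `` {x}. \<mu> x y * (f y - f x))"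

definition subharmonic_on_graph ::
    "'a set \<Rightarrow> ('a \<times> 'a) set \<Rightarrow> ('a \<Rightarrow> 'a \<Rightarrow> real) \<Rightarrow> ('a \<Rightarrow> real) \<Rightarrow> bool" where
  "subharmonic_on_graph V E \<mu> f \<longleftrightarrow> (\<forall>x\<in>V. graph_laplacian E \<mu> f x \<ge> 0)"

end

theory Submission
  imports Defs
begin

text \<open>
  The proof is a Caccioppoli estimate followed by an absorption argument in the style of Karp.
  For an ordered pair of adjacent vertices put \<open>a = f x\<close>, \<open>b = f y\<close> and consider the energy density
  \<open>Q x y = \<mu> x y * (b - a) * (b powr (q - 1) - a powr (q - 1)) \<ge> 0\<close>, which vanishes along an edge
  only if \<open>f\<close> takes the same value at both ends. By connectedness it suffices to show that the
  total energy is zero as soon as the sum of \<open>f\<^sup>q \<mu>\<close> over the ball of radius \<open>R\<close> is at most \<open>K R\<^sup>2\<close> for arbitrarily large \<open>R\<close>.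

  Testing \<open>\<Delta> f \<ge> 0\<close> against \<open>\<eta>\<^sup>2 f powr (q - 1)\<close>, where \<open>\<eta>\<close> is a cutoff that is \<open>1\<close> on a finite set
  \<open>T\<close>, vanishes near the boundary of a ball \<open>S\<close> and varies by at most \<open>2 / R\<close> along edges, and summing
  by parts bounds the \<open>\<eta>\<close>-weighted energy \<open>W\<close> of \<open>S\<close> by a sum over edges that do not lie within
  \<open>T\<close>. Cauchy-Schwarz turns this into \<open>W\<^sup>2 \<le> (W - D T) * M\<close>, where \<open>D T\<close> is the energy of \<open>T\<close> and
  \<open>M\<close> is a multiple of the sum of \<open>f\<^sup>q \<mu> / R\<^sup>2\<close> over \<open>S\<close> (lemma \<open>caccioppoli\<close>). The estimate works for all \<open>q > 1\<close>, and
  without any control on the ratio \<open>b / a\<close>, thanks to the elementary inequality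
  \<open>powr_difference_quotient_bound\<close>.

  The factor \<open>W - D T\<close> is what makes a bounded \<open>M\<close> sufficient, where a cruder estimate would need \<open>M\<close>
  to tend to \<open>0\<close>. Dropping \<open>D T\<close> gives \<open>D T \<le> W \<le> M\<close>, so all energies are bounded and have a supremum \<open>L\<close>. Since \<open>W \<le> D S \<le> L\<close>, it
  follows that \<open>(D T)\<^sup>2 \<le> (L - D T) * M\<close> for every finite \<open>T\<close>; letting \<open>T\<close> grow, the right-hand side
  tends to \<open>0\<close>, and therefore \<open>L = 0\<close> (lemma \<open>absorption\<close>).
\<close>


section \<open>Elementary inequalities\<close>

text \<open>
  After division by \<open>b powr (s + 1)\<close> this says \<open>(1 + s) t\<^sup>s \<le> 1 + s t\<close> for \<open>t = a / b \<le> 1\<close>, which is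
  Young's inequality for \<open>t powr (s / (1 + s))\<close>, a quantity that dominates \<open>t powr s\<close>.
\<close>

lemma powr_difference_lower_bound:
  fixes a b s :: real
  assumes "0 \<le> a" "a \<le> b" "s > 0"
  shows "s * (b powr s * (b - a)) \<le> (1 + s) * (b * (b powr s - a powr s))"
proof (cases "a = 0")
  case True
  then show ?thesis using assms by (simp add: algebra_simps)
next
  case False
  then have pos: "a > 0" "b > 0" using assms by auto
  define t where "t = a / b"
  have t: "0 < t" "t \<le> 1" using pos assms by (auto simp: t_def)
  have "t powr s \<le> t powr (s / (1 + s))"
    using t assms by (intro powr_mono') (auto simp: field_simps)
  also have "\<dots> = 1 powr (1 / (1 + s)) * t powr (s / (1 + s))" by simp
  also have "\<dots> \<le> 1 / (1 + s) * 1 + s / (1 + s) * t"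
    using t assms by (intro Youngs_inequality_0) (auto simp: field_simps)
  finally have young: "(1 + s) * t powr s \<le> 1 + s * t"
    using assms by (simp add: field_simps)
  have a: "a = t * b" using pos by (simp add: t_def)
  have pa: "a powr s = t powr s * b powr s"
    using t pos by (simp add: a powr_mult)
  have "0 \<le> b powr s * b * (1 + s * t - (1 + s) * t powr s)"
    using young pos by simp
  then show ?thesis unfolding pa by (simp add: a algebra_simps)
qed

text \<open>
  This is what lets Cauchy-Schwarz split the cross term of the Caccioppoli estimate into the energy
  density and \<open>f\<^sup>q\<close>. A factor \<open>(b - a)\<^sup>2\<close> is spent against \<open>(b - a) (b powr (q-1) - a powr (q-1))\<close>, and
  the larger of the two values absorbs the remaining powers.
\<close>

lemma powr_difference_quotient_bound:
  fixes a b q :: real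
  assumes "0 \<le> a" "0 \<le> b" "q > 1"
  shows "((a powr (q - 1) + b powr (q - 1)) * (b - a))\<^sup>2
    \<le> 4 * q / (q - 1) * (a powr q + b powr q) * ((b - a) * (b powr (q - 1) - a powr (q - 1)))"
  using assms(1,2)
proof (induction a b rule: linorder_wlog)
  case (sym b a)
  have "((b powr (q-1) + a powr (q-1)) * (a - b))\<^sup>2 = ((a powr (q-1) + b powr (q-1)) * (b - a))\<^sup>2"
    by (simp add: power_mult_distrib power2_commute add.commute)
  also have "\<dots> \<le> 4 * q / (q-1) * (a powr q + b powr q)
      * ((b - a) * (b powr (q-1) - a powr (q-1)))"
    using sym by blast
  also have "\<dots> = 4 * q / (q-1) * (b powr q + a powr q)
      * ((a - b) * (a powr (q-1) - b powr (q-1)))"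
    by (simp add: algebra_simps)
  finally show ?case .
next
  case (le a b)
  define A B where "A = a powr (q - 1)" and "B = b powr (q - 1)"
  have AB: "0 \<le> A" "A \<le> B"
    using le assms by (auto simp: A_def B_def powr_mono2)
  have bB: "b * B = b powr q"
    using le by (cases "b = 0") (auto simp: B_def powr_diff)
  have "(q - 1) * (B * (b - a)) \<le> (1 + (q - 1)) * (b * (B - A))"
    unfolding A_def B_def using le assms by (intro powr_difference_lower_bound) auto
  then have lower: "B * (b - a) \<le> q / (q - 1) * (b * (B - A))"
    using assms by (simp add: field_simps)
  have "(A + B) * (b - a) \<le> 2 * B * (b - a)"
    using AB le by (intro mult_right_mono) auto
  then have "((A + B) * (b - a))\<^sup>2 \<le> (2 * B * (b - a))\<^sup>2"
    using AB le by (intro power_mono) auto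
  also have "\<dots> = 4 * B * (b - a) * (B * (b - a))"
    by (simp add: power2_eq_square)
  also have "\<dots> \<le> 4 * B * (b - a) * (q / (q - 1) * (b * (B - A)))"
    using AB le by (intro mult_left_mono lower) auto
  also have "\<dots> = 4 * q / (q - 1) * b powr q * ((b - a) * (B - A))"
    by (simp add: bB[symmetric])
  also have "\<dots> \<le> 4 * q / (q - 1) * (a powr q + b powr q) * ((b - a) * (B - A))"
    using AB le assms by (intro mult_right_mono mult_left_mono) auto
  finally show ?case by (simp add: A_def B_def)
qed

lemma powr_difference_product_nonneg:
  fixes a b s :: real
  assumes "0 \<le> a" "0 \<le> b" "s > 0"
  shows "0 \<le> (b - a) * (b powr s - a powr s)"
  using assms powr_mono2[of s a b] powr_mono2[of s b a]
  by (cases "a \<le> b") (simp_all add: mult_nonpos_nonpos)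

lemma powr_difference_product_eq_0:
  fixes a b s :: real
  assumes "0 \<le> a" "0 \<le> b" "s > 0" "(b - a) * (b powr s - a powr s) = 0"
  shows "a = b"
  using assms powr_less_mono2[of s a b] powr_less_mono2[of s b a]
  by (metis eq_iff_diff_eq_0 less_irrefl linorder_neqE_linordered_idom mult_eq_0_iff)

text \<open>
  Along an exhausting family \<open>T\<close>, the hypothesis leaves no room for \<open>D T\<close> to approach its supremum
  unless that supremum is \<open>0\<close>: enlarging \<open>T\<close> by a set \<open>T\<^sub>0\<close> of positive energy would keep \<open>D T\<close> at least
  \<open>(D T\<^sub>0)\<^sup>2 / M\<close> below it.
\<close>

lemma absorption:
  fixes D :: "'a set \<Rightarrow> real" and M :: real
  assumes D_nonneg: "\<And>T. finite T \<Longrightarrow> 0 \<le> D T"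
    and D_mono: "\<And>T T'. \<lbrakk>T \<subseteq> T'; finite T'\<rbrakk> \<Longrightarrow> D T \<le> D T'"
    and M: "M > 0"
    and step: "\<And>T. \<lbrakk>T \<subseteq> V; finite T\<rbrakk> \<Longrightarrow>
      \<exists>S W. S \<subseteq> V \<and> finite S \<and> D T \<le> W \<and> W \<le> D S \<and> W\<^sup>2 \<le> (W - D T) * M"
    and T0: "T0 \<subseteq> V" "finite T0"
  shows "D T0 = 0"
proof -
  let ?\<F> = "{T. T \<subseteq> V \<and> finite T}"
  have "D T \<le> M" if T: "T \<in> ?\<F>" for T
  proof -
    obtain W where W: "D T \<le> W" "W\<^sup>2 \<le> (W - D T) * M"
      using step T by blast
    have "0 \<le> D T" using D_nonneg T by simp
    then have "(W - D T) * M \<le> W * M" using M by (intro mult_right_mono) auto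
    then have "W\<^sup>2 \<le> W * M" using W by linarith
    then have "W \<le> M"
      using W(1) \<open>0 \<le> D T\<close> M by (cases "W = 0") (auto simp: power2_eq_square)
    then show ?thesis using W(1) by simp
  qed
  then have bdd: "bdd_above (D ` ?\<F>)" by (rule bdd_aboveI2)
  define L where "L = (SUP T\<in>?\<F>. D T)"
  have "D T \<le> L - (D T0)\<^sup>2 / M" if T: "T \<in> ?\<F>" for T
  proof -
    let ?T = "T \<union> T0"
    obtain S W where W: "S \<in> ?\<F>" "D ?T \<le> W" "W \<le> D S" "W\<^sup>2 \<le> (W - D ?T) * M"
      using step[of ?T] T T0 by auto
    have "D S \<le> L" unfolding L_def by (rule cSUP_upper[OF W(1) bdd])
    have "(D T0)\<^sup>2 \<le> (D ?T)\<^sup>2"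
      using T T0 by (intro power_mono D_mono D_nonneg) auto
    also have "\<dots> \<le> W\<^sup>2"
      using W T T0 by (intro power_mono D_nonneg) auto
    also have "\<dots> \<le> (L - D ?T) * M"
      using W \<open>D S \<le> L\<close> M by (intro order_trans[OF W(4)] mult_right_mono) auto
    also have "\<dots> \<le> (L - D T) * M"
      using M T T0 by (intro mult_right_mono diff_left_mono D_mono) auto
    finally show ?thesis using M by (simp add: field_simps)
  qed
  then have "L \<le> L - (D T0)\<^sup>2 / M"
    unfolding L_def by (intro cSUP_least) auto
  then have "(D T0)\<^sup>2 \<le> 0" using M by (simp add: field_simps)
  then show ?thesis by simp
qed


section \<open>Balls in a connected, locally finite graph\<close>

context weighted_graph
begin

lemma weight_nonneg: "0 \<le> \<mu> x y"
  using weight_pos[of x y] weight_zero[of x y] by (cases "(x, y) \<in> E") auto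

lemma edge_sym: "(x, y) \<in> E \<Longrightarrow> (y, x) \<in> E"
  using edges_sym by (auto dest: symD)

lemma path_to_graph_dist:
  assumes "connected_graph V E" "x \<in> V" "p \<in> V"
  shows "(x, p) \<in> E ^^ graph_dist E x p"
proof -
  have "(x, p) \<in> E\<^sup>*" using assms by (auto simp: connected_graph_def)
  then obtain n where "(x, p) \<in> E ^^ n" by (auto simp: rtrancl_power)
  then show ?thesis unfolding graph_dist_def by (rule LeastI)
qed

lemma graph_dist_edge_le:
  assumes "connected_graph V E" "(x, y) \<in> E" "p \<in> V"
  shows "graph_dist E x p \<le> graph_dist E y p + 1"
proof -
  have "y \<in> V" using assms edges_in_vertices by auto
  then have "(x, p) \<in> E ^^ Suc (graph_dist E y p)"
    using assms path_to_graph_dist by (blast intro: relpow_Suc_I2)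
  then show ?thesis unfolding graph_dist_def[of E x p] by (simp add: Least_le)
qed

lemma finite_sphere:
  assumes "locally_finite_graph V E" "p \<in> V"
  shows "finite {x. (x, p) \<in> E ^^ n}"
proof (induction n)
  case (Suc n)
  have "{x. (x, p) \<in> E ^^ Suc n} \<subseteq> (\<Union>y\<in>{y. (y, p) \<in> E ^^ n} \<inter> V. E `` {y})"
  proof
    fix x assume "x \<in> {x. (x, p) \<in> E ^^ Suc n}"
    then obtain y where "(x, y) \<in> E" "(y, p) \<in> E ^^ n" by (blast dest: relpow_Suc_D2)
    then show "x \<in> (\<Union>y\<in>{y. (y, p) \<in> E ^^ n} \<inter> V. E `` {y})"
      using edges_in_vertices edge_sym by blast
  qed
  moreover have "finite (\<Union>y\<in>{y. (y, p) \<in> E ^^ n} \<inter> V. E `` {y})"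
    using Suc assms by (auto simp: locally_finite_graph_def)
  ultimately show ?case by (rule finite_subset)
qed simp

lemma finite_graph_ball:
  assumes "connected_graph V E" "locally_finite_graph V E" "p \<in> V"
  shows "finite (graph_ball V E p R)"
proof (rule finite_subset)
  show "graph_ball V E p R \<subseteq> (\<Union>n\<le>nat \<lfloor>R\<rfloor>. {x. (x, p) \<in> E ^^ n})"
    using path_to_graph_dist assms
    by (force simp: graph_ball_def le_nat_floor)
qed (use finite_sphere assms in auto)


section \<open>The Caccioppoli estimate\<close>

text \<open>
  Dividing by a positive vertex weight preserves the sign. The weight is zero only at an isolated
  vertex, where the sum is empty.
\<close>

lemma subharmonic_sum_nonneg:
  assumes "locally_finite_graph V E" "subharmonic_on_graph V E \<mu> f" "x \<in> V"
  shows "0 \<le> (\<Sum>y\<in>E `` {x}. \<mu> x y * (f y - f x))"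
proof (cases "E `` {x} = {}")
  case False
  have fin: "finite (E `` {x})" using assms by (simp add: locally_finite_graph_def)
  have "vertex_weight E \<mu> x > 0"
    unfolding vertex_weight_def using fin False weight_pos by (intro sum_pos) auto
  moreover have "graph_laplacian E \<mu> f x \<ge> 0"
    using assms by (simp add: subharmonic_on_graph_def)
  ultimately show ?thesis
    by (simp add: graph_laplacian_def zero_le_divide_iff)
qed simp

text \<open>
  Summation by parts: the double sum of \<open>\<phi> x * \<mu> x y * (f y - f x)\<close> is nonnegative by subharmonicity,
  and averaging it with its copy in which \<open>x\<close> and \<open>y\<close> are exchanged produces a difference of \<open>\<phi>\<close>. No
  boundary term appears because the support of \<open>\<phi>\<close> has all its neighbours in \<open>S\<close>.
\<close>

lemma subharmonic_summation_by_parts: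
  assumes "locally_finite_graph V E" "subharmonic_on_graph V E \<mu> f"
    and "finite S" "S \<subseteq> V"
    and \<phi>: "\<And>x. x \<in> S \<Longrightarrow> 0 \<le> \<phi> x"
    and supp: "\<And>x. \<lbrakk>x \<in> S; \<phi> x \<noteq> 0\<rbrakk> \<Longrightarrow> E `` {x} \<subseteq> S"
  shows "(\<Sum>(x, y)\<in>S \<times> S. \<mu> x y * (f y - f x) * (\<phi> y - \<phi> x)) \<le> 0"
proof -
  have inner: "0 \<le> (\<Sum>y\<in>S. \<phi> x * (\<mu> x y * (f y - f x)))" if "x \<in> S" for x
  proof (cases "\<phi> x = 0")
    case False
    have "(\<Sum>y\<in>S. \<mu> x y * (f y - f x)) = (\<Sum>y\<in>E `` {x}. \<mu> x y * (f y - f x))"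
      using supp[OF that False] assms(3) weight_zero
      by (intro sum.mono_neutral_right) auto
    then show ?thesis
      using subharmonic_sum_nonneg[of f x] \<phi>[OF that] that assms
      by (auto simp: sum_distrib_left[symmetric])
  qed simp
  have "0 \<le> (\<Sum>x\<in>S. \<Sum>y\<in>S. \<phi> x * (\<mu> x y * (f y - f x)))"
    by (intro sum_nonneg inner)
  moreover have "(\<Sum>x\<in>S. \<Sum>y\<in>S. \<phi> x * (\<mu> x y * (f y - f x)))
      = (\<Sum>x\<in>S. \<Sum>y\<in>S. \<phi> y * (\<mu> x y * (f x - f y)))"
    by (subst sum.swap) (simp add: weight_sym)
  ultimately have "0 \<le> (\<Sum>x\<in>S. \<Sum>y\<in>S. \<phi> x * (\<mu> x y * (f y - f x)))
      + (\<Sum>x\<in>S. \<Sum>y\<in>S. \<phi> y * (\<mu> x y * (f x - f y)))"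
    by linarith
  also have "\<dots> = - (\<Sum>x\<in>S. \<Sum>y\<in>S. \<mu> x y * (f y - f x) * (\<phi> y - \<phi> x))"
    unfolding sum.distrib[symmetric] sum_negf[symmetric]
    by (intro sum.cong refl) (simp add: algebra_simps)
  finally show ?thesis by (simp add: sum.cartesian_product)
qed

definition energy_density :: "('a \<Rightarrow> real) \<Rightarrow> real \<Rightarrow> 'a \<Rightarrow> 'a \<Rightarrow> real" where
  "energy_density f q x y = \<mu> x y * ((f y - f x) * (f y powr (q - 1) - f x powr (q - 1)))"

definition energy :: "('a \<Rightarrow> real) \<Rightarrow> real \<Rightarrow> 'a set \<Rightarrow> real" where
  "energy f q T = (\<Sum>(x, y)\<in>T \<times> T. energy_density f q x y)"

lemma energy_density_nonneg:
  assumes "\<And>x. 0 \<le> f x" "q > 1"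
  shows "0 \<le> energy_density f q x y"
  unfolding energy_density_def using assms
  by (intro mult_nonneg_nonneg weight_nonneg powr_difference_product_nonneg) auto

lemma energy_nonneg:
  assumes "\<And>x. 0 \<le> f x" "q > 1"
  shows "0 \<le> energy f q T"
  unfolding energy_def by (auto intro!: sum_nonneg energy_density_nonneg assms)

lemma energy_mono:
  assumes "\<And>x. 0 \<le> f x" "q > 1" "T \<subseteq> T'" "finite T'"
  shows "energy f q T \<le> energy f q T'"
  unfolding energy_def using assms(3,4)
  by (intro sum_mono2) (auto intro!: energy_density_nonneg assms)

lemma sum_weight_le_vertex_weight:
  assumes "locally_finite_graph V E" "finite S" "x \<in> V"
  shows "(\<Sum>y\<in>S. \<mu> x y) \<le> vertex_weight E \<mu> x"
proof -
  have "(\<Sum>y\<in>S. \<mu> x y) = (\<Sum>y\<in>S \<inter> E `` {x}. \<mu> x y)"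
    using assms weight_zero by (intro sum.mono_neutral_right) auto
  also have "\<dots> \<le> vertex_weight E \<mu> x"
    unfolding vertex_weight_def using assms weight_nonneg
    by (intro sum_mono2) (auto simp: locally_finite_graph_def)
  finally show ?thesis .
qed

lemma sum_edges_le_vertex_sum:
  assumes "locally_finite_graph V E" "finite S" "S \<subseteq> V" "\<And>x. 0 \<le> g x"
  shows "(\<Sum>(x, y)\<in>S \<times> S. \<mu> x y * (g x + g y)) \<le> 2 * (\<Sum>x\<in>S. g x * vertex_weight E \<mu> x)"
proof -
  have "(\<Sum>x\<in>S. \<Sum>y\<in>S. \<mu> x y * g y) = (\<Sum>x\<in>S. \<Sum>y\<in>S. \<mu> x y * g x)"
    by (subst sum.swap) (simp add: weight_sym)
  then have "(\<Sum>(x, y)\<in>S \<times> S. \<mu> x y * (g x + g y)) = 2 * (\<Sum>x\<in>S. \<Sum>y\<in>S. \<mu> x y * g x)"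
    by (simp add: sum.cartesian_product[symmetric] distrib_left sum.distrib)
  also have "(\<Sum>x\<in>S. \<Sum>y\<in>S. \<mu> x y * g x) = (\<Sum>x\<in>S. g x * (\<Sum>y\<in>S. \<mu> x y))"
    by (simp add: sum_distrib_left mult.commute)
  also have "\<dots> \<le> (\<Sum>x\<in>S. g x * vertex_weight E \<mu> x)"
    using assms by (intro sum_mono mult_left_mono sum_weight_le_vertex_weight) auto
  finally show ?thesis by simp
qed

text \<open>
  With the test function \<open>\<phi> = \<eta>\<^sup>2 f powr (q - 1)\<close>, splitting \<open>\<phi> y - \<phi> x\<close> symmetrically as
  \<open>w * (B - A) + (\<eta>\<^sub>y\<^sup>2 - \<eta>\<^sub>x\<^sup>2) / 2 * (A + B)\<close>, with \<open>w = (\<eta>\<^sub>x\<^sup>2 + \<eta>\<^sub>y\<^sup>2) / 2\<close>, isolates the weighted energy.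
  The symmetric form matters: the cross term carries \<open>\<bar>\<eta>\<^sub>y\<^sup>2 - \<eta>\<^sub>x\<^sup>2\<bar> \<le> 2 \<epsilon> sqrt w\<close>, so Cauchy-Schwarz returns
  exactly the weighted energy, and only of edges outside \<open>T\<close>, without a remainder \<open>\<epsilon>\<^sup>2 \<Sum> f\<^sup>q \<mu>\<close> that
  would stay bounded but not become small.
\<close>

lemma caccioppoli:
  assumes graph: "locally_finite_graph V E"
    and f: "\<And>x. 0 \<le> f x" "subharmonic_on_graph V E \<mu> f"
    and q: "q > 1"
    and S: "finite S" "S \<subseteq> V" "T \<subseteq> S"
    and \<eta>: "\<And>x. 0 \<le> \<eta> x" "\<And>x. \<eta> x \<le> (1::real)" "\<And>x. x \<in> T \<Longrightarrow> \<eta> x = 1"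
    and supp: "\<And>x. \<lbrakk>x \<in> S; \<eta> x \<noteq> 0\<rbrakk> \<Longrightarrow> E `` {x} \<subseteq> S"
    and lip: "\<And>x y. (x, y) \<in> E \<Longrightarrow> \<bar>\<eta> y - \<eta> x\<bar> \<le> \<epsilon>"
  shows "\<exists>W. energy f q T \<le> W \<and> W \<le> energy f q S \<and>
    W\<^sup>2 \<le> (W - energy f q T) *
      (8 * q / (q - 1) * (\<epsilon>\<^sup>2 * (\<Sum>x\<in>S. f x powr q * vertex_weight E \<mu> x)))"
proof -
  define F where "F = (\<lambda>x. f x powr (q - 1))"
  define w where "w = (\<lambda>x y. ((\<eta> x)\<^sup>2 + (\<eta> y)\<^sup>2) / 2)"
  define Q where "Q = energy_density f q"
  define cross where
    "cross = (\<lambda>x y. \<mu> x y * (((\<eta> y)\<^sup>2 - (\<eta> x)\<^sup>2) / 2 * ((F x + F y) * (f y - f x))))"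
  define h where "h = (\<lambda>x y. \<mu> x y * (f x powr q + f y powr q))"
  define C where "C = 4 * q / (q - 1)"
  define W where "W = (\<Sum>(x, y)\<in>S \<times> S. w x y * Q x y)"
  define U where "U = S \<times> S - T \<times> T"
  have C: "C > 0" using q by (simp add: C_def)
  have Q: "0 \<le> Q x y" for x y
    unfolding Q_def by (intro energy_density_nonneg f q)
  have sq: "(\<eta> x)\<^sup>2 \<le> 1" for x
    using \<eta>(1,2) by (simp add: power_le_one)
  have w: "0 \<le> w x y" "w x y \<le> 1" for x y
    using sq[of x] sq[of y] by (auto simp: w_def)
  have h: "0 \<le> h x y" for x y
    by (simp add: h_def weight_nonneg)
  have WS: "W \<le> energy f q S"
    unfolding W_def energy_def Q_def[symmetric]
    using w Q by (auto intro!: sum_mono mult_left_le_one_le)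
  have WT: "W = (\<Sum>(x, y)\<in>U. w x y * Q x y) + energy f q T"
  proof -
    have "energy f q T = (\<Sum>(x, y)\<in>T \<times> T. w x y * Q x y)"
      unfolding energy_def Q_def[symmetric] by (auto intro!: sum.cong simp: w_def \<eta>(3))
    moreover have "T \<times> T \<subseteq> S \<times> S" "finite (S \<times> S)" using S by auto
    note sum.subset_diff[OF this, of "\<lambda>(x, y). w x y * Q x y"]
    ultimately show ?thesis unfolding W_def U_def by simp
  qed
  have U_nonneg: "0 \<le> (\<Sum>(x, y)\<in>U. w x y * Q x y)"
    by (auto intro!: sum_nonneg mult_nonneg_nonneg w Q)
  have "(\<Sum>(x, y)\<in>S \<times> S. \<mu> x y * (f y - f x) * ((\<eta> y)\<^sup>2 * F y - (\<eta> x)\<^sup>2 * F x)) \<le> 0"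
    using graph f S supp by (intro subharmonic_summation_by_parts) (auto simp: F_def)
  also have "(\<Sum>(x, y)\<in>S \<times> S. \<mu> x y * (f y - f x) * ((\<eta> y)\<^sup>2 * F y - (\<eta> x)\<^sup>2 * F x))
      = W + (\<Sum>(x, y)\<in>S \<times> S. cross x y)"
    unfolding W_def sum.distrib[symmetric]
    by (intro sum.cong refl)
      (auto simp: w_def Q_def energy_density_def F_def cross_def field_simps)
  finally have "W \<le> - (\<Sum>(x, y)\<in>S \<times> S. cross x y)" by linarith
  also have "(\<Sum>(x, y)\<in>S \<times> S. cross x y) = (\<Sum>(x, y)\<in>U. cross x y)"
    unfolding U_def using S
    by (intro sum.mono_neutral_right) (auto simp: cross_def \<eta>(3))
  also have "- \<dots> \<le> (\<Sum>(x, y)\<in>U. sqrt (w x y * Q x y) * sqrt (\<epsilon>\<^sup>2 * C * h x y))"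
  proof -
    have "- cross x y \<le> sqrt (w x y * Q x y) * sqrt (\<epsilon>\<^sup>2 * C * h x y)" for x y
    proof (cases "(x, y) \<in> E")
      case False
      then show ?thesis using w Q C h by (simp add: cross_def weight_zero)
    next
      case True
      have "((\<eta> y)\<^sup>2 - (\<eta> x)\<^sup>2)\<^sup>2 = (\<eta> y - \<eta> x)\<^sup>2 * (\<eta> y + \<eta> x)\<^sup>2"
        by (simp add: power2_eq_square algebra_simps)
      also have "\<dots> \<le> \<epsilon>\<^sup>2 * (4 * w x y)"
      proof (intro mult_mono)
        show "(\<eta> y - \<eta> x)\<^sup>2 \<le> \<epsilon>\<^sup>2"
          using power_mono[OF lip[OF True], of 2] by simp
        show "(\<eta> y + \<eta> x)\<^sup>2 \<le> 4 * w x y"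
          using zero_le_power2[of "\<eta> y - \<eta> x"]
          by (simp add: w_def power2_eq_square algebra_simps)
      qed auto
      finally have cut: "(((\<eta> y)\<^sup>2 - (\<eta> x)\<^sup>2) / 2)\<^sup>2 \<le> \<epsilon>\<^sup>2 * w x y"
        by (simp add: power_divide)
      have "(cross x y)\<^sup>2 = (\<mu> x y)\<^sup>2 * ((((\<eta> y)\<^sup>2 - (\<eta> x)\<^sup>2) / 2)\<^sup>2 * ((F x + F y) * (f y - f x))\<^sup>2)"
        unfolding cross_def power_mult_distrib by simp
      also have "\<dots> \<le> (\<mu> x y)\<^sup>2 * ((\<epsilon>\<^sup>2 * w x y) *
          (C * (f x powr q + f y powr q) * ((f y - f x) * (F y - F x))))"
        unfolding C_def F_def using cut w f q
        by (intro mult_left_mono mult_mono powr_difference_quotient_bound) auto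
      also have "\<dots> = (w x y * Q x y) * (\<epsilon>\<^sup>2 * C * h x y)"
        by (simp add: Q_def energy_density_def F_def h_def power2_eq_square)
      finally have "\<bar>cross x y\<bar> \<le> sqrt ((w x y * Q x y) * (\<epsilon>\<^sup>2 * C * h x y))"
        by (simp add: real_le_rsqrt)
      then show ?thesis by (simp add: real_sqrt_mult)
    qed
    then show ?thesis by (auto simp: sum_negf[symmetric] intro!: sum_mono)
  qed
  finally have W_le: "W \<le> (\<Sum>(x, y)\<in>U. sqrt (w x y * Q x y) * sqrt (\<epsilon>\<^sup>2 * C * h x y))" .
  have "0 \<le> W"
    using WT U_nonneg energy_nonneg[of f q T] f q by simp
  then have "W\<^sup>2 \<le> (\<Sum>(x, y)\<in>U. sqrt (w x y * Q x y) * sqrt (\<epsilon>\<^sup>2 * C * h x y))\<^sup>2"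
    by (intro power_mono W_le)
  also have "\<dots> \<le> (\<Sum>(x, y)\<in>U. (sqrt (w x y * Q x y))\<^sup>2) * (\<Sum>(x, y)\<in>U. (sqrt (\<epsilon>\<^sup>2 * C * h x y))\<^sup>2)"
    unfolding case_prod_unfold by (rule Cauchy_Schwarz_ineq_sum)
  also have "\<dots> = (\<Sum>(x, y)\<in>U. w x y * Q x y) * (\<Sum>(x, y)\<in>U. \<epsilon>\<^sup>2 * C * h x y)"
    using w Q C h by simp
  also have "\<dots> \<le> (\<Sum>(x, y)\<in>U. w x y * Q x y) * (\<Sum>(x, y)\<in>S \<times> S. \<epsilon>\<^sup>2 * C * h x y)"
  proof (intro mult_left_mono U_nonneg sum_mono2)
    show "U \<subseteq> S \<times> S" "finite (S \<times> S)" using S by (auto simp: U_def)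
    show "0 \<le> (case z of (x, y) \<Rightarrow> \<epsilon>\<^sup>2 * C * h x y)" for z
      using C h by (auto split: prod.split)
  qed
  also have "\<dots> = (\<Sum>(x, y)\<in>U. w x y * Q x y) * (\<epsilon>\<^sup>2 * C * (\<Sum>(x, y)\<in>S \<times> S. h x y))"
    by (simp add: sum_distrib_left case_prod_unfold)
  also have "\<dots> \<le> (\<Sum>(x, y)\<in>U. w x y * Q x y)
      * (\<epsilon>\<^sup>2 * C * (2 * (\<Sum>x\<in>S. f x powr q * vertex_weight E \<mu> x)))"
    unfolding h_def using graph S C
    by (intro mult_left_mono U_nonneg sum_edges_le_vertex_sum) auto
  also have "\<dots> = (W - energy f q T) *
      (8 * q / (q - 1) * (\<epsilon>\<^sup>2 * (\<Sum>x\<in>S. f x powr q * vertex_weight E \<mu> x)))"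
    by (simp add: WT C_def)
  finally have "W\<^sup>2 \<le> (W - energy f q T) *
      (8 * q / (q - 1) * (\<epsilon>\<^sup>2 * (\<Sum>x\<in>S. f x powr q * vertex_weight E \<mu> x)))" .
  moreover have "energy f q T \<le> W" using WT U_nonneg by linarith
  ultimately show ?thesis using WS by blast
qed


section \<open>Quadratic growth forces constancy\<close>

text \<open>
  The cutoff is the piecewise linear function of the distance that equals \<open>1\<close> up to distance
  \<open>R / 2 - 1\<close> and \<open>0\<close> from distance \<open>R - 1\<close> on; the shift by one step keeps the neighbours of its
  support inside the ball of radius \<open>R\<close>.
\<close>

lemma energy_eq_0_if_quadratic_growth:
  assumes graph: "connected_graph V E" "locally_finite_graph V E" "p \<in> V"
    and f: "\<And>x. 0 \<le> f x" "subharmonic_on_graph V E \<mu> f"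
    and q: "q > 1" and K: "K > 0"
    and growth: "\<And>R0. \<exists>R\<ge>R0. (\<Sum>x\<in>graph_ball V E p R. f x powr q * vertex_weight E \<mu> x) \<le> K * R\<^sup>2"
    and T: "T \<subseteq> V" "finite T"
  shows "energy f q T = 0"
proof (rule absorption[where M = "8 * q / (q - 1) * (4 * K)"])
  show "0 < 8 * q / (q - 1) * (4 * K)" using q K by simp
next
  fix T assume T: "T \<subseteq> V" "finite T"
  define m where "m = Max (insert 0 ((\<lambda>x. graph_dist E x p) ` T))"
  have m: "graph_dist E x p \<le> m" if "x \<in> T" for x
    using T that by (auto simp: m_def)
  obtain R where R: "R \<ge> 2 * real m + 2"
    and sum_le: "(\<Sum>x\<in>graph_ball V E p R. f x powr q * vertex_weight E \<mu> x) \<le> K * R\<^sup>2"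
    using growth by blast
  have "R > 0" by (rule less_le_trans[OF _ R]) simp
  define S where "S = graph_ball V E p R"
  define g where "g = (\<lambda>x. 2 * (1 - (real (graph_dist E x p) + 1) / R))"
  define \<eta> where "\<eta> = (\<lambda>x. max 0 (min 1 (g x)))"
  have S: "finite S" "S \<subseteq> V"
    using finite_graph_ball graph by (auto simp: S_def graph_ball_def)
  have "T \<subseteq> S"
  proof
    fix x assume "x \<in> T"
    then show "x \<in> S" using m[of x] T R by (auto simp: S_def graph_ball_def)
  qed
  moreover have "\<eta> x = 1" if "x \<in> T" for x
  proof -
    have "2 * (real (graph_dist E x p) + 1) \<le> R" using m[OF that] R by simp
    then have "1 \<le> g x" using \<open>R > 0\<close> by (simp add: g_def field_simps)
    then show ?thesis by (simp add: \<eta>_def)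
  qed
  moreover have "E `` {x} \<subseteq> S" if x: "x \<in> S" "\<eta> x \<noteq> 0" for x
  proof
    fix y assume "y \<in> E `` {x}"
    then have y: "(y, x) \<in> E" by (auto intro: edge_sym)
    have "g x > 0" using x by (auto simp: \<eta>_def max_def split: if_splits)
    then have "real (graph_dist E x p) + 1 < R"
      using \<open>R > 0\<close> by (simp add: g_def field_simps)
    moreover have "graph_dist E y p \<le> graph_dist E x p + 1"
      using graph_dist_edge_le graph y by blast
    moreover have "y \<in> V" using y edges_in_vertices by auto
    ultimately show "y \<in> S" by (simp add: S_def graph_ball_def)
  qed
  moreover have "\<bar>\<eta> y - \<eta> x\<bar> \<le> 2 / R" if xy: "(x, y) \<in> E" for x y
  proof -
    define \<delta> where "\<delta> = real (graph_dist E x p) - real (graph_dist E y p)"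
    have "\<bar>\<delta>\<bar> \<le> 1"
      using graph_dist_edge_le[of x y p] graph_dist_edge_le[of y x p] graph xy edge_sym[OF xy]
      by (simp add: \<delta>_def)
    moreover have "g y - g x = 2 / R * \<delta>"
      using \<open>R > 0\<close> by (simp add: g_def \<delta>_def field_simps)
    ultimately have "\<bar>g y - g x\<bar> \<le> 2 / R"
      using \<open>R > 0\<close> by (simp add: abs_mult divide_right_mono)
    then show ?thesis unfolding \<eta>_def by linarith
  qed
  ultimately have "\<exists>W. energy f q T \<le> W \<and> W \<le> energy f q S \<and>
    W\<^sup>2 \<le> (W - energy f q T) *
      (8 * q / (q - 1) * ((2 / R)\<^sup>2 * (\<Sum>x\<in>S. f x powr q * vertex_weight E \<mu> x)))"
    using graph f q S by (intro caccioppoli[where \<eta> = \<eta>]) (auto simp: \<eta>_def)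
  then obtain W where W: "energy f q T \<le> W" "W \<le> energy f q S"
    "W\<^sup>2 \<le> (W - energy f q T) *
      (8 * q / (q - 1) * ((2 / R)\<^sup>2 * (\<Sum>x\<in>S. f x powr q * vertex_weight E \<mu> x)))"
    by blast
  have "(2 / R)\<^sup>2 * (\<Sum>x\<in>S. f x powr q * vertex_weight E \<mu> x) \<le> (2 / R)\<^sup>2 * (K * R\<^sup>2)"
    unfolding S_def by (intro mult_left_mono sum_le) auto
  also have "\<dots> = 4 * K" using \<open>R > 0\<close> by (simp add: power_divide)
  finally have "W\<^sup>2 \<le> (W - energy f q T) * (8 * q / (q - 1) * (4 * K))"
    using q W(1) by (intro order_trans[OF W(3)] mult_left_mono) auto
  then show "\<exists>S W. S \<subseteq> V \<and> finite S \<and> energy f q T \<le> W \<and> W \<le> energy f q S \<and>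
      W\<^sup>2 \<le> (W - energy f q T) * (8 * q / (q - 1) * (4 * K))"
    using S W by blast
qed (use energy_nonneg energy_mono f q T in auto)

lemma constant_if_energy_eq_0:
  assumes "connected_graph V E" "\<And>x. 0 \<le> f x" "q > 1"
    and "\<And>T. \<lbrakk>T \<subseteq> V; finite T\<rbrakk> \<Longrightarrow> energy f q T = 0"
  shows "f constant_on V"
proof -
  have edge: "f x = f y" if xy: "(x, y) \<in> E" for x y
  proof -
    have "energy f q {x, y} = 0" using xy edges_in_vertices by (intro assms(4)) auto
    then have "\<forall>z\<in>{x, y} \<times> {x, y}. (case z of (x, y) \<Rightarrow> energy_density f q x y) = 0"
      unfolding energy_def
      by (subst (asm) sum_nonneg_eq_0_iff) (auto intro: energy_density_nonneg assms)
    then have "energy_density f q x y = 0" by simp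
    then have product: "(f y - f x) * (f y powr (q - 1) - f x powr (q - 1)) = 0"
      using weight_pos[OF xy] by (simp add: energy_density_def)
    show ?thesis using assms(2,3) by (intro powr_difference_product_eq_0[OF _ _ _ product]) auto
  qed
  have "f x = f y" if "(x, y) \<in> E\<^sup>*" for x y
    using that by induction (auto dest: edge)
  then show ?thesis
    using assms(1) unfolding connected_graph_def constant_on_def by metis
qed

end

lemma quadratic_growth_if_Liminf_finite:
  fixes F :: "real \<Rightarrow> real"
  assumes "Liminf at_top (\<lambda>R. ereal (1 / R\<^sup>2 * F R)) \<noteq> \<infinity>"
  obtains K where "K > 0" "\<And>R0. \<exists>R\<ge>R0. F R \<le> K * R\<^sup>2"
proof -
  have "\<not> ((\<lambda>R. ereal (1 / R\<^sup>2 * F R)) \<longlongrightarrow> \<infinity>) at_top"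
    using assms by (auto dest: lim_imp_Liminf[rotated])
  then obtain r where r: "\<not> (\<forall>\<^sub>F R in at_top. r < 1 / R\<^sup>2 * F R)"
    by (auto simp: tendsto_PInfty)
  show ?thesis
  proof (rule that)
    show "max r 1 > 0" by simp
    fix R0 :: real
    obtain R where R: "R \<ge> max R0 1" "1 / R\<^sup>2 * F R \<le> r"
      using r unfolding eventually_at_top_linorder by (meson not_less)
    have "F R \<le> r * R\<^sup>2" using R by (simp add: field_simps)
    also have "\<dots> \<le> max r 1 * R\<^sup>2" by (intro mult_right_mono) auto
    finally show "\<exists>R\<ge>R0. F R \<le> max r 1 * R\<^sup>2" using R(1) by auto
  qed
qed


section \<open>The Liouville theorem\<close>

theorem theorem1p1:
  fixes V :: "'a set" and E :: "('a \<times> 'a) set" and \<mu> :: "'a \<Rightarrow> 'a \<Rightarrow> real"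
    and p :: 'a and f :: "'a \<Rightarrow> real"
  assumes "weighted_graph V E \<mu>"
    and "infinite V"
    and "connected_graph V E"
    and "locally_finite_graph V E"
    and "p \<in> V"
    and "\<And>x. x \<in> V \<Longrightarrow> f x \<ge> 0"
    and "subharmonic_on_graph V E \<mu> f"
  shows "f constant_on V \<or>
    (\<forall>q::real. q > 1 \<longrightarrow>
      Liminf at_top (\<lambda>R::real.
        ereal (1 / R\<^sup>2 * (\<Sum>x\<in>graph_ball V E p R. f x powr q * vertex_weight E \<mu> x))) = \<infinity>)"
proof (rule disjCI)
  interpret weighted_graph V E \<mu> by fact
  assume "\<not> (\<forall>q::real. q > 1 \<longrightarrow>
      Liminf at_top (\<lambda>R::real.
        ereal (1 / R\<^sup>2 * (\<Sum>x\<in>graph_ball V E p R. f x powr q * vertex_weight E \<mu> x))) = \<infinity>)"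
  then obtain q where q: "q > 1"
    and finite_liminf: "Liminf at_top (\<lambda>R::real.
        ereal (1 / R\<^sup>2 * (\<Sum>x\<in>graph_ball V E p R. f x powr q * vertex_weight E \<mu> x))) \<noteq> \<infinity>"
    by blast
  obtain K where K: "K > 0"
    "\<And>R0. \<exists>R\<ge>R0. (\<Sum>x\<in>graph_ball V E p R. f x powr q * vertex_weight E \<mu> x) \<le> K * R\<^sup>2"
    using quadratic_growth_if_Liminf_finite[OF finite_liminf] by blast
  \<comment> \<open>Values off \<open>V\<close> never enter; replacing them by \<open>0\<close> makes the function nonnegative everywhere.\<close>
  define g where "g = (\<lambda>x. if x \<in> V then f x else 0)"
  have g: "0 \<le> g x" for x using assms(6) by (simp add: g_def)
  have "graph_laplacian E \<mu> g x = graph_laplacian E \<mu> f x" if "x \<in> V" for x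
  proof -
    have "(\<Sum>y\<in>E `` {x}. \<mu> x y * (g y - g x)) = (\<Sum>y\<in>E `` {x}. \<mu> x y * (f y - f x))"
      using that edges_in_vertices by (intro sum.cong) (auto simp: g_def)
    then show ?thesis by (simp add: graph_laplacian_def)
  qed
  then have "subharmonic_on_graph V E \<mu> g"
    using assms(7) by (simp add: subharmonic_on_graph_def)
  moreover have "(\<Sum>x\<in>graph_ball V E p R. g x powr q * vertex_weight E \<mu> x)
      = (\<Sum>x\<in>graph_ball V E p R. f x powr q * vertex_weight E \<mu> x)" for R
    by (intro sum.cong) (auto simp: g_def graph_ball_def)
  ultimately have "energy g q T = 0" if "T \<subseteq> V" "finite T" for T
    using assms(3-5) g q K that by (intro energy_eq_0_if_quadratic_growth[where K = K and p = p]) auto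
  then have "g constant_on V"
    using assms(3) g q by (intro constant_if_energy_eq_0[of g q]) auto
  then show "f constant_on V" by (auto simp: constant_on_def g_def)
qed

end
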